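(* Let $k$ be a positive rational with $k<3$ and $\varepsilon$ a positive real with $\varepsilon\ge\frac{1}{k+1}$. If $G$ is a fractionally $k$-colorable graph and $W\subseteq V(G)$ is a set of vertices at pairwise distance at least seven, then every fractional $(k+\varepsilon)$-precoloring of $W$ extends to a fractional $(k+\varepsilon)$-coloring of $G$.
   Context: A fractional $m$-coloring of a graph (real $m>0$) assigns to each vertex a measurable subset of $[0,m)$ of Lebesgue measure one so that adjacent vertices receive disjoint sets; a graph is fractionally $k$-colorable if it has a fractional $k$-coloring. A fractional $m$-precoloring of a vertex set $W$ assigns measurable subsets of $[0,m)$ of measure one to the vertices of $W$; it extends if some fractional $m$-coloring of the whole graph agrees with it on $W$. Graphs are finite. *)

theory Defs
  imports "HOL-Analysis.Analysis"
begin

definition graph :: "'a set \<Rightarrow> ('a \<Rightarrow> 'a \<Rightarrow> bool) \<Rightarrow> bool" where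
  "graph V E \<longleftrightarrow> finite V \<and> (\<forall>u v. E u v \<longrightarrow> u \<in> V \<and> v \<in> V)
     \<and> (\<forall>u v. E u v \<longrightarrow> E v u) \<and> (\<forall>v. \<not> E v v)"

fun walk_len :: "('a \<Rightarrow> 'a \<Rightarrow> bool) \<Rightarrow> nat \<Rightarrow> 'a \<Rightarrow> 'a \<Rightarrow> bool" where
  "walk_len E 0 u v \<longleftrightarrow> u = v"
| "walk_len E (Suc n) u v \<longleftrightarrow> (\<exists>w. E u w \<and> walk_len E n w v)"

definition dist_ge :: "('a \<Rightarrow> 'a \<Rightarrow> bool) \<Rightarrow> nat \<Rightarrow> 'a \<Rightarrow> 'a \<Rightarrow> bool" where
  "dist_ge E d u v \<longleftrightarrow> (\<forall>n<d. \<not> walk_len E n u v)"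

definition unit_set :: "real \<Rightarrow> real set \<Rightarrow> bool" where
  "unit_set m A \<longleftrightarrow> A \<in> sets lebesgue \<and> A \<subseteq> {0..<m} \<and> emeasure lebesgue A = 1"

definition frac_coloring :: "'a set \<Rightarrow> ('a \<Rightarrow> 'a \<Rightarrow> bool) \<Rightarrow> real \<Rightarrow> ('a \<Rightarrow> real set) \<Rightarrow> bool" where
  "frac_coloring V E m c \<longleftrightarrow> (\<forall>v\<in>V. unit_set m (c v))
     \<and> (\<forall>u v. E u v \<longrightarrow> c u \<inter> c v = {})"

definition frac_colorable :: "'a set \<Rightarrow> ('a \<Rightarrow> 'a \<Rightarrow> bool) \<Rightarrow> real \<Rightarrow> bool" where
  "frac_colorable V E m \<longleftrightarrow> (\<exists>c. frac_coloring V E m c)"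

definition frac_precoloring :: "'a set \<Rightarrow> real \<Rightarrow> ('a \<Rightarrow> real set) \<Rightarrow> bool" where
  "frac_precoloring W m p \<longleftrightarrow> (\<forall>w\<in>W. unit_set m (p w))"

definition extends :: "'a set \<Rightarrow> ('a \<Rightarrow> 'a \<Rightarrow> bool) \<Rightarrow> real \<Rightarrow> 'a set \<Rightarrow> ('a \<Rightarrow> real set) \<Rightarrow> bool" where
  "extends V E m W p \<longleftrightarrow> (\<exists>c. frac_coloring V E m c \<and> (\<forall>w\<in>W. c w = p w))"

end

(* Put m = k + \<epsilon> and let c be a fractional k-coloring. Choose maps g from [0,m) to [0,k) and h
   from [0,m) to [0,k+1) that behave like random variables, uniform and independent of each other
   and of all the precolors. Far from W recolor v by the set of x with g x \<in> c v, of measure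
   m/k > 1. The radius-3 balls around the vertices w of W are disjoint, so each ball can be treated
   separately. The precolor p w forces the neighbors of w to leave p w; in exchange they take,
   outside p w, a 1/k fraction of the default color class of w (they can share it since k < 3
   excludes triangles). The vertices at distance two give this part up and are compensated by the
   colors x \<in> p w with h x \<in> c w, a 1/(k+1) fraction of p w, on which they are colored through h
   instead of g. The vertices at distance three release exactly these colors, which their
   surplus \<epsilon>/k \<ge> 1/(k(k+1)) allows. *)

theory Submission
  imports Defs
begin

section \<open>Splitting sets independently of a finite family\<close>

text \<open>The measure of the part of \<open>A\<close> left of \<open>s\<close> is 1-Lipschitz in
  \<open>s\<close> and rises from 0 to the measure of \<open>A\<close>, so the intermediate value
  theorem supplies the cut.\<close>

lemma lmeasurable_subset_of_measure:
  fixes A :: "real set"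
  assumes A: "A \<in> lmeasurable" "bounded A" and t: "0 \<le> t" "t \<le> measure lebesgue A"
  obtains B where "B \<subseteq> A" "B \<in> lmeasurable" "measure lebesgue B = t"
proof -
  obtain r where r: "0 < r" "A \<subseteq> {-r..r}"
    using A(2) unfolding bounded_pos
    by (metis abs_le_iff atLeastAtMost_iff minus_le_iff real_norm_def subsetI)
  define f where "f s = measure lebesgue (A \<inter> {-r..s})" for s
  have lm: "A \<inter> {-r..s} \<in> lmeasurable" for s
    using A(1) by (intro fmeasurable.Int) auto
  have mono: "f s \<le> f s'" and lip: "f s' \<le> f s + (s' - s)" if "s \<le> s'" for s s'
  proof -
    show "f s \<le> f s'"
      unfolding f_def using that by (intro measure_mono_fmeasurable) (auto simp: fmeasurableD lm)
    have "f s' \<le> measure lebesgue ((A \<inter> {-r..s}) \<union> {s..s'})"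
      unfolding f_def using that
      by (intro measure_mono_fmeasurable fmeasurable.Un lm) (auto simp: fmeasurableD lm)
    also have "\<dots> \<le> measure lebesgue (A \<inter> {-r..s}) + measure lebesgue {s..s'}"
      by (intro measure_Un_le) (auto simp: fmeasurableD lm)
    finally show "f s' \<le> f s + (s' - s)"
      using that by (simp add: f_def)
  qed
  have "1-lipschitz_on {-r..r} f"
  proof (rule lipschitz_onI)
    show "dist (f s) (f s') \<le> 1 * dist s s'" for s s'
      using mono[of s s'] mono[of s' s] lip[of s s'] lip[of s' s]
      by (cases "s \<le> s'") (auto simp: dist_real_def abs_le_iff)
  qed simp
  then have "continuous_on {-r..r} f"
    by (rule lipschitz_on_continuous_on)
  moreover have "f (-r) \<le> t"
  proof -
    have "f (-r) \<le> measure lebesgue {-r}"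
      unfolding f_def using fmeasurableD[OF lm, of "-r"]
      by (intro measure_mono_fmeasurable) (auto simp: lmeasurable_compact)
    then show ?thesis using t by simp
  qed
  moreover have "A \<inter> {-r..r} = A" using r by auto
  then have "t \<le> f r" using t by (simp add: f_def)
  ultimately obtain s where "f s = t"
    using IVT'[of f "-r" t r] r by auto
  then show ?thesis
    using that[of "A \<inter> {-r..s}"] lm by (auto simp: f_def)
qed

text \<open>Cut off one piece of measure \<open>q l\<close> and recurse on the rest. The partition
  is encoded by a labelling \<open>f\<close>, which is total so that its values lie in
  \<open>L\<close> outside \<open>A\<close> too.\<close>

lemma lmeasurable_split:
  fixes A :: "real set" and q :: "'l \<Rightarrow> real"
  assumes "finite L" "L \<noteq> {}" "\<And>l. l \<in> L \<Longrightarrow> 0 \<le> q l"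
    and "A \<in> lmeasurable" "bounded A" "measure lebesgue A = sum q L"
  shows "\<exists>f. (\<forall>x. f x \<in> L) \<and>
    (\<forall>l\<in>L. A \<inter> f -` {l} \<in> lmeasurable \<and> measure lebesgue (A \<inter> f -` {l}) = q l)"
  using assms
proof (induction L arbitrary: A rule: finite_ne_induct)
  case (singleton l)
  then show ?case by (intro exI[of _ "\<lambda>_. l"]) auto
next
  case (insert l L)
  have "q l \<le> measure lebesgue A"
    using insert by (simp add: sum_nonneg)
  then obtain B where B: "B \<subseteq> A" "B \<in> lmeasurable" "measure lebesgue B = q l"
    using lmeasurable_subset_of_measure[OF insert.prems(2,3), of "q l"] insert.prems(1) by auto
  have "measure lebesgue (A - B) = sum q L"
    using insert B by (simp add: measurable_measure_Diff fmeasurableD)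
  moreover have "A - B \<in> lmeasurable" "bounded (A - B)"
    using insert B by (auto intro: fmeasurable.Diff bounded_subset)
  ultimately obtain f where f: "\<forall>x. f x \<in> L"
    "\<forall>l\<in>L. (A - B) \<inter> f -` {l} \<in> lmeasurable \<and> measure lebesgue ((A - B) \<inter> f -` {l}) = q l"
    using insert.IH[of "A - B"] insert.prems by auto
  define f' where "f' x = (if x \<in> B then l else f x)" for x
  have "A \<inter> f' -` {l} = B" "\<And>i. i \<in> L \<Longrightarrow> A \<inter> f' -` {i} = (A - B) \<inter> f -` {i}"
    using f(1) B(1) insert.hyps by (auto simp: f'_def split: if_splits)
  then have "\<forall>i\<in>insert l L. A \<inter> f' -` {i} \<in> lmeasurable \<and> measure lebesgue (A \<inter> f' -` {i}) = q i"
    using f(2) B(2,3) by (simp only: ball_simps) simp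
  moreover have "\<forall>x. f' x \<in> insert l L"
    using f(1) by (simp add: f'_def)
  ultimately show ?case by blast
qed

lemma lmeasurable_ico: "{a..<b::real} \<in> lmeasurable"
  by (rule bounded_set_imp_lmeasurable) auto

lemma measure_fibres:
  fixes X :: "'a::euclidean_space set"
  assumes "finite I" "\<And>x. x \<in> X \<Longrightarrow> f x \<in> I" "\<And>i. i \<in> I \<Longrightarrow> X \<inter> f -` {i} \<in> lmeasurable"
  shows "X \<in> lmeasurable" "measure lebesgue X = (\<Sum>i\<in>I. measure lebesgue (X \<inter> f -` {i}))"
proof -
  have X: "X = (\<Union>i\<in>I. X \<inter> f -` {i})"
    using assms(2) by auto
  show "X \<in> lmeasurable"
    by (subst X) (intro fmeasurable.finite_UN assms)
  show "measure lebesgue X = (\<Sum>i\<in>I. measure lebesgue (X \<inter> f -` {i}))"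
  proof (subst X, rule measure_finite_Union[OF assms(1)])
    show "(\<lambda>i. X \<inter> f -` {i}) ` I \<subseteq> sets lebesgue"
      using fmeasurableD[OF assms(3)] by blast
    show "disjoint_family_on (\<lambda>i. X \<inter> f -` {i}) I"
      by (auto simp: disjoint_family_on_def)
    show "emeasure lebesgue (X \<inter> f -` {i}) \<noteq> \<infinity>" if "i \<in> I" for i
      using fmeasurableD2[OF assms(3)[OF that]] by simp
  qed
qed

lemma lmeasurable_atom:
  fixes U :: "'a::euclidean_space set"
  assumes "finite F" "F \<subseteq> lmeasurable" "U \<in> lmeasurable"
  shows "U \<inter> (\<lambda>x. {A \<in> F. x \<in> A}) -` {T} \<in> lmeasurable"
proof (cases "T \<subseteq> F")
  case True
  \<comment> \<open>A point of \<open>U\<close> has trace \<open>T\<close> iff it avoids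
    \<open>U - A\<close> for each \<open>A\<close> in \<open>T\<close> and avoids every other
    \<open>A\<close> in \<open>F\<close>.\<close>
  then have "U \<inter> (\<lambda>x. {A \<in> F. x \<in> A}) -` {T} = U - (\<Union>A\<in>F. if A \<in> T then U - A else A)"
    by (auto split: if_splits)
  then show ?thesis
    using assms by (simp only:) (intro fmeasurable.Diff fmeasurable.finite_UN; auto)
next
  case False
  then have "U \<inter> (\<lambda>x. {A \<in> F. x \<in> A}) -` {T} = {}" by auto
  then show ?thesis by simp
qed

text \<open>Provides a substitute for a uniform random variable on \<open>[0,k)\<close> independent
  of \<open>F\<close>. Only finitely many events are tested, so it is enough to get the masses of
  atoms right, and \<open>g\<close> itself need not be measurable.\<close>

lemma independent_map:
  fixes F C :: "real set set" and k :: real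
  assumes F: "finite F" "F \<subseteq> lmeasurable" "\<And>A. A \<in> F \<Longrightarrow> bounded A"
    and C: "finite C" "C \<subseteq> lmeasurable" "\<And>B. B \<in> C \<Longrightarrow> B \<subseteq> {0..<k}" and k: "0 < k"
  obtains g where "\<And>A B. A \<in> F \<Longrightarrow> B \<in> C \<Longrightarrow> A \<inter> g -` B \<in> lmeasurable"
    and "\<And>A B. A \<in> F \<Longrightarrow> B \<in> C \<Longrightarrow>
      measure lebesgue (A \<inter> g -` B) = measure lebesgue A * measure lebesgue B / k"
proof -
  \<comment> \<open>\<open>\<tau>\<close> and \<open>\<sigma>\<close> map a point to its atom of \<open>F\<close> resp. \<open>C\<close>; each atom of \<open>F\<close> is split in the
    proportions of the atoms of \<open>C\<close>.\<close>
  define U where "U = \<Union>F"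
  define \<tau> where "\<tau> x = {A \<in> F. x \<in> A}" for x
  define \<sigma> where "\<sigma> y = {B \<in> C. y \<in> B}" for y
  define L where "L = \<sigma> ` {0..<k}"
  define \<beta> where "\<beta> S = measure lebesgue ({0..<k} \<inter> \<sigma> -` {S})" for S
  define atm where "atm T = U \<inter> \<tau> -` {T}" for T
  have U: "U \<in> lmeasurable" "bounded U"
    using F unfolding U_def by (auto intro: fmeasurable.finite_Union)
  have finL: "finite L"
    by (rule finite_subset[of _ "Pow C"]) (auto simp: L_def \<sigma>_def C(1))
  have "L \<noteq> {}" using k by (auto simp: L_def)
  have atm: "atm T \<in> lmeasurable" for T
    using lmeasurable_atom[OF F(1,2) U(1)] by (simp add: atm_def \<tau>_def[abs_def])
  have \<sigma>m: "{0..<k} \<inter> \<sigma> -` {S} \<in> lmeasurable" for S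
    using lmeasurable_atom[OF C(1,2), OF lmeasurable_ico] by (simp add: \<sigma>_def[abs_def])
  have \<beta>: "sum \<beta> L = k"
    using measure_fibres(2)[of L "{0..<k}" \<sigma>] finL \<sigma>m k by (auto simp: \<beta>_def L_def)
  have "\<exists>f. (\<forall>x. f x \<in> L) \<and> (\<forall>S\<in>L. atm T \<inter> f -` {S} \<in> lmeasurable \<and>
      measure lebesgue (atm T \<inter> f -` {S}) = measure lebesgue (atm T) * \<beta> S / k)" for T
  proof (rule lmeasurable_split[OF finL \<open>L \<noteq> {}\<close> _ atm])
    show "bounded (atm T)" using U(2) by (auto simp: atm_def intro: bounded_subset)
    show "measure lebesgue (atm T) = (\<Sum>S\<in>L. measure lebesgue (atm T) * \<beta> S / k)"
      using \<beta> k by (simp flip: sum_divide_distrib sum_distrib_left)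
  qed (use k in \<open>auto simp: \<beta>_def\<close>)
  then obtain f where fL: "\<And>T x. f T x \<in> L"
    and f: "\<And>T S. S \<in> L \<Longrightarrow> atm T \<inter> f T -` {S} \<in> lmeasurable"
    "\<And>T S. S \<in> L \<Longrightarrow> measure lebesgue (atm T \<inter> f T -` {S}) = measure lebesgue (atm T) * \<beta> S / k"
    by metis
  \<comment> \<open>\<open>L\<close> is the image of \<open>{0..<k}\<close> under
    \<open>\<sigma>\<close>, so each label is realised by some point. Any such point will do, since
    the sets in \<open>C\<close> only see its atom.\<close>
  have "\<exists>g. \<forall>x. g x \<in> {0..<k} \<and> \<sigma> (g x) = f (\<tau> x) x"
    using fL unfolding L_def by (intro choice) (metis imageE)
  then obtain g where g: "\<And>x. g x \<in> {0..<k}" "\<And>x. \<sigma> (g x) = f (\<tau> x) x"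
    by blast
  have "A \<inter> g -` B \<in> lmeasurable \<and>
      measure lebesgue (A \<inter> g -` B) = measure lebesgue A * measure lebesgue B / k"
    if AB: "A \<in> F" "B \<in> C" for A B
  proof -
    define P where "P = {T \<in> Pow F. A \<in> T}"
    define Q where "Q = {S \<in> L. B \<in> S}"
    have fin: "finite P" "finite Q" using F(1) finL by (auto simp: P_def Q_def)
    have gB: "g x \<in> B \<longleftrightarrow> B \<in> f (\<tau> x) x" for x
      using g(2)[of x] AB(2) by (auto simp: \<sigma>_def)
    have AU: "A \<inter> \<tau> -` {T} = atm T" if "T \<in> P" for T
      using that AB(1) by (auto simp: atm_def P_def \<tau>_def U_def)
    have BS: "B \<inter> \<sigma> -` {S} = {0..<k} \<inter> \<sigma> -` {S}" if "S \<in> Q" for S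
      using that AB(2) C(3) by (auto simp: Q_def \<sigma>_def)
    have "x \<in> A \<Longrightarrow> \<tau> x \<in> P" "x \<in> B \<Longrightarrow> \<sigma> x \<in> Q" for x
      using AB C(3) by (auto simp: P_def Q_def \<tau>_def \<sigma>_def L_def)
    note PQ = this
    have mA: "measure lebesgue A = (\<Sum>T\<in>P. measure lebesgue (atm T))"
      using measure_fibres(2)[of P A \<tau>] by (simp add: PQ AU atm fin)
    have mB: "measure lebesgue B = (\<Sum>S\<in>Q. \<beta> S)"
      using measure_fibres(2)[of Q B \<sigma>] by (simp add: PQ BS \<sigma>m fin \<beta>_def)
    have fib: "(A \<inter> g -` B) \<inter> (\<lambda>x. (\<tau> x, f (\<tau> x) x)) -` {i} = atm (fst i) \<inter> f (fst i) -` {snd i}"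
      if "i \<in> P \<times> Q" for i
      using that unfolding AU[OF mem_Times_iff[THEN iffD1, OF that, THEN conjunct1], symmetric]
      by (auto simp: Q_def gB)
    have fibres: "finite (P \<times> Q)" "\<And>x. x \<in> A \<inter> g -` B \<Longrightarrow> (\<tau> x, f (\<tau> x) x) \<in> P \<times> Q"
      "\<And>i. i \<in> P \<times> Q \<Longrightarrow> (A \<inter> g -` B) \<inter> (\<lambda>x. (\<tau> x, f (\<tau> x) x)) -` {i} \<in> lmeasurable"
      using fin fL f(1) PQ(1) by (simp_all only: fib) (auto simp: gB Q_def)
    have "measure lebesgue (A \<inter> g -` B)
        = (\<Sum>i\<in>P \<times> Q. measure lebesgue (atm (fst i)) * \<beta> (snd i) / k)"
      using measure_fibres(2)[where f = "\<lambda>x. (\<tau> x, f (\<tau> x) x)", OF fibres]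
      by (simp only:) (intro sum.cong refl, subst fib, auto simp: f(2) Q_def)
    also have "\<dots> = measure lebesgue A * measure lebesgue B / k"
      unfolding mA mB sum_product sum.cartesian_product
      by (simp add: sum_divide_distrib case_prod_beta)
    finally show ?thesis using measure_fibres(1)[where f = "\<lambda>x. (\<tau> x, f (\<tau> x) x)", OF fibres] by blast
  qed
  then show ?thesis using that by blast
qed

section \<open>Walks and distances\<close>

lemma walk_len_trans: "walk_len E i u v \<Longrightarrow> walk_len E j v w \<Longrightarrow> walk_len E (i + j) u w"
  by (induction i arbitrary: u) auto

lemma walk_len_snoc: "walk_len E i u v \<Longrightarrow> E v w \<Longrightarrow> walk_len E (Suc i) u w"
  using walk_len_trans[of E i u v 1 w] by simp

lemma walk_len_sym:
  assumes "\<And>u v. E u v \<Longrightarrow> E v u"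
  shows "walk_len E i u v \<Longrightarrow> walk_len E i v u"
  by (induction i arbitrary: u) (simp, metis walk_len.simps(2) walk_len_snoc assms)

text \<open>A relation instead of a distance function, so that vertices without a connecting walk
  need no conventional value.\<close>

definition at_dist :: "('a \<Rightarrow> 'a \<Rightarrow> bool) \<Rightarrow> nat \<Rightarrow> 'a \<Rightarrow> 'a \<Rightarrow> bool" where
  "at_dist E n u v \<longleftrightarrow> walk_len E n u v \<and> dist_ge E n u v"

lemma at_dist_unique: "at_dist E i u v \<Longrightarrow> at_dist E j u v \<Longrightarrow> i = j"
  unfolding at_dist_def dist_ge_def by (metis linorder_neqE_nat)

lemma walk_len_imp_at_dist:
  assumes "walk_len E i u v"
  obtains j where "j \<le> i" "at_dist E j u v"
  using exists_least_iff[of "\<lambda>i. walk_len E i u v"] assms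
  unfolding at_dist_def dist_ge_def by (metis not_le)

lemma at_dist_adjacent: "at_dist E i u v \<Longrightarrow> at_dist E j u w \<Longrightarrow> E v w \<Longrightarrow> j \<le> Suc i"
  unfolding at_dist_def dist_ge_def by (meson not_le walk_len_snoc)

section \<open>Modifying a coloring around the precolored vertices\<close>

lemma measure_disjoint_Un:
  "A \<in> lmeasurable \<Longrightarrow> B \<in> lmeasurable \<Longrightarrow> A \<inter> B = {} \<Longrightarrow>
    measure lebesgue (A \<union> B) = measure lebesgue A + measure lebesgue B"
  using fmeasurableD2[of A lebesgue] fmeasurableD2[of B lebesgue]
  by (intro measure_Union) (simp_all add: fmeasurableD del: emeasure_completion)

lemma measure_Diff_subset:
  "A \<in> lmeasurable \<Longrightarrow> B \<in> lmeasurable \<Longrightarrow> B \<subseteq> A \<Longrightarrow>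
    measure lebesgue (A - B) = measure lebesgue A - measure lebesgue B"
  by (simp add: measurable_measure_Diff fmeasurableD)

lemma unit_setD:
  assumes "unit_set m A"
  shows "A \<in> lmeasurable" "A \<subseteq> {0..<m}" "measure lebesgue A = 1"
  using assms by (auto simp: unit_set_def fmeasurable_def measure_def)

lemma unit_set_ge_1: "unit_set m A \<Longrightarrow> 1 \<le> m"
  using measure_mono_fmeasurable[of A "{0..<m}" lebesgue] unit_setD[of m A]
  by (cases "0 \<le> m") (auto simp: lmeasurable_ico fmeasurableD)

lemma unit_sets_triangle:
  assumes "unit_set m A" "unit_set m B" "unit_set m C"
    and "A \<inter> B = {}" "B \<inter> C = {}" "A \<inter> C = {}"
  shows "3 \<le> m"
proof -
  note A = unit_setD[OF assms(1)] and B = unit_setD[OF assms(2)] and C = unit_setD[OF assms(3)]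
  have "(A \<union> B) \<inter> C = {}" using assms by blast
  then have "3 = measure lebesgue (A \<union> B \<union> C)"
    using A B C assms by (simp add: measure_disjoint_Un fmeasurable.Un)
  also have "\<dots> \<le> measure lebesgue {0..<m}"
    using A B C by (intro measure_mono_fmeasurable) (auto simp: lmeasurable_ico fmeasurableD)
  finally show ?thesis
    using unit_set_ge_1[OF assms(1)] by simp
qed

section \<open>The setting: a default coloring and two independent maps\<close>

text \<open>The assumptions \<open>g\<close>, \<open>h\<close> and \<open>gh\<close> list exactly
  the product formulas that uniform \<open>g\<close> on \<open>[0,k)\<close> and \<open>h\<close> on
  \<open>[0,k+1)\<close>, independent of each other and of the precolors, would satisfy. All later
  measures reduce to arithmetic with them.\<close>

locale recoloring =
  fixes V :: "'a set" and E :: "'a \<Rightarrow> 'a \<Rightarrow> bool" and W :: "'a set"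
    and k m :: real and c p :: "'a \<Rightarrow> real set" and g h :: "real \<Rightarrow> real"
  assumes graph: "graph V E"
    and coloring: "frac_coloring V E k c"
    and k: "1 \<le> k" "k < 3" and m: "k + 1 / (k + 1) \<le> m"
    and W: "W \<subseteq> V"
    and far_apart: "\<And>u v. u \<in> W \<Longrightarrow> v \<in> W \<Longrightarrow> u \<noteq> v \<Longrightarrow> dist_ge E 7 u v"
    and precoloring: "frac_precoloring W m p"
    \<comment> \<open>\<open>u = v\<close> is allowed in \<open>c u \<inter> c v\<close>, which then is \<open>c v\<close>.\<close>
    and g: "\<And>A u v. A \<in> {{0..<m}} \<union> p ` W \<union> (\<lambda>w. {0..<m} - p w) ` W \<Longrightarrow> u \<in> V \<Longrightarrow> v \<in> V \<Longrightarrow>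
      A \<inter> g -` (c u \<inter> c v) \<in> lmeasurable \<and>
      measure lebesgue (A \<inter> g -` (c u \<inter> c v))
        = measure lebesgue A * measure lebesgue (c u \<inter> c v) / k"
    and h: "\<And>A B. A \<in> {{0..<m}} \<union> p ` W \<union> (\<lambda>w. {0..<m} - p w) ` W \<Longrightarrow>
      B \<in> {{0..<(k + 1) / k}} \<union> (\<lambda>(u, v). c u \<inter> c v) ` (V \<times> V) \<Longrightarrow>
      A \<inter> h -` B \<in> lmeasurable \<and>
      measure lebesgue (A \<inter> h -` B) = measure lebesgue A * measure lebesgue B / (k + 1)"
    and gh: "\<And>A u v B. A \<in> {{0..<m}} \<union> p ` W \<union> (\<lambda>w. {0..<m} - p w) ` W \<Longrightarrow> u \<in> V \<Longrightarrow> v \<in> V \<Longrightarrow>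
      B \<in> {{0..<(k + 1) / k}} \<union> (\<lambda>(u, v). c u \<inter> c v) ` (V \<times> V) \<Longrightarrow>
      A \<inter> g -` (c u \<inter> c v) \<inter> h -` B \<in> lmeasurable \<and>
      measure lebesgue (A \<inter> g -` (c u \<inter> c v) \<inter> h -` B)
        = measure lebesgue A * measure lebesgue (c u \<inter> c v) / k * measure lebesgue B / (k + 1)"
begin

definition base :: "'a \<Rightarrow> real set" where
  "base v = {x \<in> {0..<m}. g x \<in> c v}"

text \<open>\<open>near n w v\<close> is the set for a vertex \<open>v\<close> at distance \<open>n \<le> 3\<close> from \<open>w\<close>; larger \<open>n\<close> are junk.
  The interval for \<open>h\<close> takes up a fraction \<open>1 / k\<close> of \<open>[0, k + 1)\<close>.\<close>

fun near :: "nat \<Rightarrow> 'a \<Rightarrow> 'a \<Rightarrow> real set" where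
  "near 0 w v = p w"
| "near (Suc 0) w v =
    {x \<in> {0..<m}. x \<notin> p w \<and> (g x \<in> c v \<or> g x \<in> c w \<and> h x \<in> {0..<(k + 1) / k})}"
| "near (Suc (Suc 0)) w v =
    {x \<in> {0..<m}. if x \<in> p w then (if h x \<in> c w then h x \<in> c v else g x \<in> c v)
      else g x \<in> c v \<and> \<not> (g x \<in> c w \<and> h x \<in> {0..<(k + 1) / k})}"
| "near (Suc (Suc (Suc n))) w v = {x \<in> {0..<m}. g x \<in> c v \<and> \<not> (x \<in> p w \<and> h x \<in> c w)}"

lemma edge_sym: "E u v \<Longrightarrow> E v u"
  and edge_irrefl: "\<not> E v v"
  and edge_V: "E u v \<Longrightarrow> u \<in> V" "E u v \<Longrightarrow> v \<in> V"
  using graph by (auto simp: graph_def)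

lemma c_unit: "v \<in> V \<Longrightarrow> unit_set k (c v)"
  and c_disjoint: "E u v \<Longrightarrow> c u \<inter> c v = {}"
  using coloring by (auto simp: frac_coloring_def)

lemma p_unit: "w \<in> W \<Longrightarrow> unit_set m (p w)"
  using precoloring by (auto simp: frac_precoloring_def)

lemma triangle_free:
  assumes "E u v" "E v w"
  shows "\<not> E u w"
proof
  assume "E u w"
  have "3 \<le> k"
    by (rule unit_sets_triangle[of k "c u" "c v" "c w"])
      (intro c_unit c_disjoint edge_V[OF assms(1)] edge_V[OF assms(2)] assms \<open>E u w\<close>)+
  then show False using k by simp
qed

lemma near_subset: "w \<in> W \<Longrightarrow> near n w v \<subseteq> {0..<m}"
  using unit_setD(2)[OF p_unit] by (cases "(n, w, v)" rule: near.cases) auto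

lemma near_3_subset_base: "near 3 w v \<subseteq> base v"
  by (auto simp: base_def numeral_3_eq_3)

section \<open>Measures of the recolored sets\<close>

text \<open>Here \<open>m - 1\<close> is the measure of the complement of a precolor, and
  \<open>k - 1 + 1 / (k + 1) = k\<^sup>2 / (k + 1)\<close>. This is the form in which the bound on
  \<open>\<epsilon>\<close> enters at distances one, two and three.\<close>

lemma m_minus_1: "k\<^sup>2 / (k + 1) \<le> m - 1"
  using m k by (simp add: field_simps power2_eq_square)

lemma base_measure:
  assumes "v \<in> V"
  shows "base v \<in> lmeasurable" "1 \<le> measure lebesgue (base v)"
proof -
  have d: "base v = {0..<m} \<inter> g -` (c v \<inter> c v)"
    by (auto simp: base_def)
  have "k \<le> m" using m k by (smt (verit) divide_nonneg_nonneg)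
  then show "base v \<in> lmeasurable" "1 \<le> measure lebesgue (base v)"
    using g[of "{0..<m}" v v] assms unit_setD(3)[OF c_unit[OF assms]] k
    unfolding d by auto
qed

text \<open>Each set is split into its part in \<open>P = p w\<close> and its part in the complement
  \<open>Q\<close>, and both are computed from the product formulas. For \<open>n\<close> equal to
  1, 2 or 3 the lower bound obtained from \<open>M\<close> is exactly 1.\<close>

lemma near_measure:
  assumes w: "w \<in> W" and v: "v \<in> V" and "n = 1 \<Longrightarrow> E w v"
  shows "near n w v \<in> lmeasurable \<and> 1 \<le> measure lebesgue (near n w v)"
proof -
  define P where "P = p w"
  define Q where "Q = {0..<m} - p w"
  define M where "M = m - 1"
  define J where "J = {0..<(k + 1) / k}"
  define q where "q = measure lebesgue (c v \<inter> c w)"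
  have wV: "w \<in> V" using w W by auto
  note c = unit_setD[OF c_unit[OF v]] unit_setD[OF c_unit[OF wV]]
  note P1 = unit_setD[OF p_unit[OF w]]
  have P: "measure lebesgue P = 1" "P \<subseteq> {0..<m}" using P1 by (auto simp: P_def)
  have Q: "measure lebesgue Q = M"
    unfolding Q_def M_def using P1 unit_set_ge_1[OF p_unit[OF w]]
    by (simp add: measure_Diff_subset lmeasurable_ico)
  have PQ: "P \<inter> Q = {}" by (auto simp: P_def Q_def)
  have M: "k\<^sup>2 / (k + 1) \<le> M" using m_minus_1 by (simp add: M_def)
  have J: "measure lebesgue J = (k + 1) / k"
    using k by (simp add: J_def)
  have q: "0 \<le> q" "q \<le> 1"
    unfolding q_def using c
    by (simp, metis inf_le1 fmeasurable.Int fmeasurableD measure_mono_fmeasurable)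
  \<comment> \<open>\<open>J\<close> fills a fraction \<open>1 / k\<close> of
    \<open>[0,k+1)\<close>, so requiring \<open>h x \<in> J\<close> divides a measure by
    \<open>k\<close>.\<close>
  have cancel: "x / k * ((k + 1) / k) / (k + 1) = x / k\<^sup>2" for x
    using k by (simp add: divide_simps power2_eq_square)
  have G: "A \<inter> g -` c u \<in> lmeasurable"
      "measure lebesgue (A \<inter> g -` c u) = measure lebesgue A / k"
      "A \<inter> g -` c u \<inter> h -` c w \<in> lmeasurable"
      "measure lebesgue (A \<inter> g -` c u \<inter> h -` c w) = measure lebesgue A / k / (k + 1)"
      "A \<inter> g -` c u \<inter> h -` J \<in> lmeasurable"
      "measure lebesgue (A \<inter> g -` c u \<inter> h -` J) = measure lebesgue A / k\<^sup>2"
      "A \<inter> h -` (c v \<inter> c w) \<in> lmeasurable"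
      "measure lebesgue (A \<inter> h -` (c v \<inter> c w)) = measure lebesgue A * q / (k + 1)"
      "A \<inter> g -` (c v \<inter> c w) \<inter> h -` J \<in> lmeasurable"
      "measure lebesgue (A \<inter> g -` (c v \<inter> c w) \<inter> h -` J) = measure lebesgue A * q / k\<^sup>2"
    if "A \<in> {P, Q}" "u \<in> {v, w}" for A u
  proof -
    have A: "A \<in> {{0..<m}} \<union> p ` W \<union> (\<lambda>w. {0..<m} - p w) ` W"
      using that w by (auto simp: P_def Q_def)
    have u: "u \<in> V" "measure lebesgue (c u) = 1" using that v wV c by auto
    have B: "J \<in> {{0..<(k + 1) / k}} \<union> (\<lambda>(u, v). c u \<inter> c v) ` (V \<times> V)"
      "c w \<inter> c w \<in> {{0..<(k + 1) / k}} \<union> (\<lambda>(u, v). c u \<inter> c v) ` (V \<times> V)"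
      "c v \<inter> c w \<in> {{0..<(k + 1) / k}} \<union> (\<lambda>(u, v). c u \<inter> c v) ` (V \<times> V)"
      using v wV by (auto simp: J_def)
    show "A \<inter> g -` c u \<in> lmeasurable"
      "measure lebesgue (A \<inter> g -` c u) = measure lebesgue A / k"
      using g[OF A u(1) u(1)] u by auto
    show "A \<inter> g -` c u \<inter> h -` c w \<in> lmeasurable"
      "measure lebesgue (A \<inter> g -` c u \<inter> h -` c w) = measure lebesgue A / k / (k + 1)"
      using gh[OF A u(1) u(1) B(2)] u c by auto
    show "A \<inter> g -` c u \<inter> h -` J \<in> lmeasurable"
      "measure lebesgue (A \<inter> g -` c u \<inter> h -` J) = measure lebesgue A / k\<^sup>2"
      using gh[OF A u(1) u(1) B(1)] unfolding J cancel by (simp_all add: u)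
    show "A \<inter> h -` (c v \<inter> c w) \<in> lmeasurable"
      "measure lebesgue (A \<inter> h -` (c v \<inter> c w)) = measure lebesgue A * q / (k + 1)"
      using h[OF A B(3)] by (auto simp: q_def)
    show "A \<inter> g -` (c v \<inter> c w) \<inter> h -` J \<in> lmeasurable"
      "measure lebesgue (A \<inter> g -` (c v \<inter> c w) \<inter> h -` J) = measure lebesgue A * q / k\<^sup>2"
      using gh[OF A v wV B(1)] unfolding J cancel by (simp_all add: q_def)
  qed
  \<comment> \<open>The part of \<open>P\<close> still colored through \<open>g\<close> once the
    colors with \<open>h x \<in> c w\<close> are released. It is common to distances two and
    three.\<close>
  define R where "R = P \<inter> g -` c v - P \<inter> g -` c v \<inter> h -` c w"
  have "R \<in> lmeasurable"
    unfolding R_def by (intro fmeasurable.Diff G) auto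
  moreover have "measure lebesgue R
      = measure lebesgue (P \<inter> g -` c v) - measure lebesgue (P \<inter> g -` c v \<inter> h -` c w)"
    unfolding R_def by (intro measure_Diff_subset G) auto
  then have "measure lebesgue R = 1 / k - 1 / k / (k + 1)"
    by (simp add: G P)
  ultimately have R: "R \<in> lmeasurable" "measure lebesgue R = 1 / k - 1 / k / (k + 1)"
    by simp_all
  consider "n = 0" | "n = 1" | "n = 2" | l where "n = Suc (Suc (Suc l))"
    by (metis One_nat_def Suc_1 not0_implies_Suc)
  then show ?thesis
  proof cases
    case 1
    then show ?thesis using P1 by simp
  next
    case 2
    \<comment> \<open>Adjacency to \<open>w\<close> makes the own part and the part borrowed from
      \<open>c w\<close> disjoint, so their measures add.\<close>
    have disj: "c w \<inter> c v = {}" using assms(3) 2 c_disjoint by blast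
    have eq: "near n w v = (Q \<inter> g -` c v) \<union> (Q \<inter> g -` c w \<inter> h -` J)"
      using 2 by (auto simp: Q_def J_def)
    have "measure lebesgue (near n w v) = M / k + M / k\<^sup>2"
      unfolding eq using disj by (subst measure_disjoint_Un) (auto simp: G Q)
    also have "\<dots> = M * (k + 1) / k\<^sup>2"
      using k by (simp add: field_simps power2_eq_square)
    also have "\<dots> \<ge> 1"
      using M k by (simp add: field_simps)
    finally show ?thesis
      unfolding eq using G by (auto intro: fmeasurable.Un)
  next
    case 3
    \<comment> \<open>What is left in \<open>Q\<close> after yielding the colors borrowed by the
      neighbors of \<open>w\<close>. The loss is proportional to the overlap \<open>q\<close> of
      \<open>c v\<close> and \<open>c w\<close>, and so is the gain through \<open>h\<close> inside
      \<open>P\<close>.\<close>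
    define S where "S = Q \<inter> g -` c v - Q \<inter> g -` (c v \<inter> c w) \<inter> h -` J"
    have eq: "near n w v = (P \<inter> h -` (c v \<inter> c w) \<union> R) \<union> S"
    proof (rule set_eqI)
      show "x \<in> near n w v \<longleftrightarrow> x \<in> (P \<inter> h -` (c v \<inter> c w) \<union> R) \<union> S" for x
        using P(2) unfolding \<open>n = 2\<close> numeral_2_eq_2
        by (cases "x \<in> P") (auto simp: P_def Q_def R_def S_def J_def)
    qed
    have "measure lebesgue S
        = measure lebesgue (Q \<inter> g -` c v) - measure lebesgue (Q \<inter> g -` (c v \<inter> c w) \<inter> h -` J)"
      unfolding S_def by (intro measure_Diff_subset G) auto
    then have Sm: "measure lebesgue S = M / k - M * q / k\<^sup>2"
      using G(2)[of Q v] G(10)[of Q v] Q by simp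
    have S: "S \<in> lmeasurable"
      unfolding S_def by (intro fmeasurable.Diff G) auto
    have "P \<inter> h -` (c v \<inter> c w) \<inter> R = {}" by (auto simp: R_def)
    then have PR: "P \<inter> h -` (c v \<inter> c w) \<union> R \<in> lmeasurable"
      "measure lebesgue (P \<inter> h -` (c v \<inter> c w) \<union> R) = q / (k + 1) + (1 / k - 1 / k / (k + 1))"
      using measure_disjoint_Un[OF G(7) R(1), of P v] R G(7,8)[of P v] P
      by (auto intro: fmeasurable.Un)
    have "(P \<inter> h -` (c v \<inter> c w) \<union> R) \<inter> S = {}"
      using PQ by (auto simp: R_def S_def)
    then have "measure lebesgue (near n w v)
        = q / (k + 1) + (1 / k - 1 / k / (k + 1)) + (M / k - M * q / k\<^sup>2)"
      unfolding eq using measure_disjoint_Un[OF PR(1) S] PR(2) Sm by simp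
    \<comment> \<open>Since \<open>q \<le> 1 \<le> k\<close>, the coefficient of \<open>M\<close> is
      nonnegative and \<open>M\<close> may be replaced by its lower bound. Then loss and gain in
      \<open>q\<close> cancel.\<close>
    also have "\<dots> = (1 + q) / (k + 1) + M * ((k - q) / k\<^sup>2)"
      using k by (simp add: divide_simps power2_eq_square) (simp add: algebra_simps)
    also have "\<dots> \<ge> (1 + q) / (k + 1) + k\<^sup>2 / (k + 1) * ((k - q) / k\<^sup>2)"
      using M q k by (intro add_left_mono mult_right_mono) auto
    also have "(1 + q) / (k + 1) + k\<^sup>2 / (k + 1) * ((k - q) / k\<^sup>2) = 1"
      using k by (simp add: divide_simps)
    finally show ?thesis
      unfolding eq using PR(1) S by (auto intro: fmeasurable.Un)
  next
    case 4
    have eq: "near n w v = R \<union> (Q \<inter> g -` c v)"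
      using 4 P(2) by (auto simp: P_def Q_def R_def)
    have "R \<inter> (Q \<inter> g -` c v) = {}" using PQ by (auto simp: R_def)
    then have "measure lebesgue (near n w v) = 1 / k - 1 / k / (k + 1) + M / k"
      unfolding eq using measure_disjoint_Un[OF R(1) G(1), of Q v] R G(2)[of Q v] Q by simp
    also have "\<dots> = 1 / (k + 1) + M * (1 / k)"
      using k by (simp add: divide_simps)
    also have "\<dots> \<ge> 1 / (k + 1) + k\<^sup>2 / (k + 1) * (1 / k)"
      using M k by (intro add_left_mono mult_right_mono) auto
    also have "1 / (k + 1) + k\<^sup>2 / (k + 1) * (1 / k) = 1"
      using k by (simp add: divide_simps power2_eq_square)
    finally show ?thesis
      unfolding eq using R G(1)[of Q v] by (auto intro: fmeasurable.Un)
  qed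
qed

section \<open>Disjointness along edges\<close>

text \<open>Distances from \<open>w\<close> differ by at most one along an edge, leaving seven
  cases. Two neighbors of \<open>w\<close> may share borrowed colors, but they are never adjacent
  because there are no triangles. The other cases follow from \<open>c u \<inter> c v = {}\<close>
  and from the colors that the farther vertex yields.\<close>

lemma near_disjoint:
  assumes "E u v" "at_dist E i w u" "at_dist E j w v" "j \<le> 3" "i \<le> j"
  shows "near i w u \<inter> near j w v = {}"
proof -
  have "i = 0 \<or> i = 1 \<or> i = 2 \<or> i = 3" using assms(4,5) by linarith
  moreover have "j = i \<or> j = Suc i"
    using at_dist_adjacent[OF assms(2,3,1)] assms(5) by linarith
  ultimately consider "i = 0" "j = 0" | "i = 1" "j = 1" | "i = 0" "j = 1" | "i = 1" "j = 2"
    | "i = 2" "j = 2" | "i = 2" "j = 3" | "i = 3" "j = 3"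
    using assms(4) by (elim disjE) simp_all
  then show ?thesis
  proof cases
    case 1
    then have "u = v" using assms by (simp add: at_dist_def)
    then show ?thesis using assms edge_irrefl by blast
  next
    case 2
    then have "E w u" "E w v" using assms by (auto simp: at_dist_def)
    then show ?thesis using assms triangle_free edge_sym by blast
  next
    case 3
    then show ?thesis by auto
  next
    case 4
    show ?thesis
      unfolding 4 numeral_2_eq_2 One_nat_def near.simps if_bool_eq_conj
      using c_disjoint[OF assms(1)] by blast
  next
    case 5
    show ?thesis
      unfolding 5 numeral_2_eq_2 near.simps if_bool_eq_conj
      using c_disjoint[OF assms(1)] by blast
  next
    case 6
    show ?thesis
      unfolding 6 numeral_2_eq_2 numeral_3_eq_3 near.simps if_bool_eq_conj
      using c_disjoint[OF assms(1)] by blast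
  next
    case 7
    show ?thesis
      unfolding 7 numeral_3_eq_3 near.simps using c_disjoint[OF assms(1)] by blast
  qed
qed

text \<open>Two centers within distance three of \<open>v\<close> would be joined by a walk of
  length at most six.\<close>

lemma center_unique:
  assumes "w \<in> W" "w' \<in> W" "at_dist E i w v" "at_dist E j w' v" "i \<le> 3" "j \<le> 3"
  shows "w = w'" "i = j"
proof -
  show w: "w = w'"
  proof (rule ccontr)
    assume "w \<noteq> w'"
    have "walk_len E (i + j) w w'"
      using assms(3,4) walk_len_sym[of E, OF edge_sym] by (auto simp: at_dist_def intro: walk_len_trans)
    then show False
      using far_apart[OF assms(1,2) \<open>w \<noteq> w'\<close>] assms(5,6) by (auto simp: dist_ge_def)
  qed
  show "i = j" using assms w at_dist_unique by metis
qed

text \<open>The pair chosen by \<open>SOME\<close> is unique, by \<open>center_unique\<close>.\<close>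

definition recolor :: "'a \<Rightarrow> real set" where
  "recolor v = (if \<exists>n w. w \<in> W \<and> n \<le> 3 \<and> at_dist E n w v
    then let (n, w) = SOME (n, w). w \<in> W \<and> n \<le> 3 \<and> at_dist E n w v in near n w v
    else base v)"

lemma recolor_near:
  assumes "w \<in> W" "n \<le> 3" "at_dist E n w v"
  shows "recolor v = near n w v"
proof -
  have "(SOME (n, w). w \<in> W \<and> n \<le> 3 \<and> at_dist E n w v) = (n, w)"
  proof (rule some_equality)
    show "z = (n, w)" if "case z of (n, w) \<Rightarrow> w \<in> W \<and> n \<le> 3 \<and> at_dist E n w v" for z
    proof (cases z)
      case (Pair i w')
      then show ?thesis
        using center_unique[of w' w i v n] that assms by simp
    qed
  qed (use assms in simp)
  then show ?thesis unfolding recolor_def using assms by (subst if_P) (blast, simp)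
qed

lemma recolor_base:
  "\<not> (\<exists>n w. w \<in> W \<and> n \<le> 3 \<and> at_dist E n w v) \<Longrightarrow> recolor v = base v"
  unfolding recolor_def by (rule if_not_P)

text \<open>From distance three on, colors are only removed. This settles edges between vertices at
  distance three from different centers, which may occur when the centers are at distance
  seven.\<close>

lemma recolor_subset_base:
  assumes "\<And>n w. w \<in> W \<Longrightarrow> n < 3 \<Longrightarrow> \<not> at_dist E n w v"
  shows "recolor v \<subseteq> base v"
proof (cases "\<exists>n w. w \<in> W \<and> n \<le> 3 \<and> at_dist E n w v")
  case True
  then obtain w where "w \<in> W" "at_dist E 3 w v"
    using assms by (metis le_neq_implies_less)
  then show ?thesis using recolor_near[of w 3 v] near_3_subset_base by simp
next
  case False
  show ?thesis unfolding recolor_base[OF False] by (rule subset_refl)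
qed

text \<open>With \<open>u\<close> within distance two of \<open>w\<close>, the neighbor
  \<open>v\<close> is within distance three of the same \<open>w\<close>, so both sets are built
  around one center.\<close>

lemma recolor_disjoint_aux:
  assumes E: "E u v" and w: "w \<in> W" and i: "i < 3" "at_dist E i w u"
  shows "recolor u \<inter> recolor v = {}"
proof -
  have "walk_len E (Suc i) w v"
    using i(2) E unfolding at_dist_def by (blast intro: walk_len_snoc)
  then obtain j where j: "j \<le> Suc i" "at_dist E j w v"
    by (rule walk_len_imp_at_dist)
  have "recolor u = near i w u" "recolor v = near j w v"
    using recolor_near w i j by auto
  then show ?thesis
    using near_disjoint[OF E i(2) j(2)] near_disjoint[OF edge_sym[OF E] j(2) i(2)] i j
    by (cases "i \<le> j") auto
qed

lemma recolor_disjoint: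
  assumes E: "E u v"
  shows "recolor u \<inter> recolor v = {}"
proof (cases "\<exists>w i. w \<in> W \<and> i < 3 \<and> (at_dist E i w u \<or> at_dist E i w v)")
  case True
  then obtain w i where w: "w \<in> W" "i < 3" "at_dist E i w u \<or> at_dist E i w v"
    by blast
  from w(3) show ?thesis
  proof
    assume "at_dist E i w u"
    with w show ?thesis by (intro recolor_disjoint_aux[OF E])
  next
    assume "at_dist E i w v"
    with w have "recolor v \<inter> recolor u = {}"
      by (intro recolor_disjoint_aux[OF edge_sym[OF E]])
    then show ?thesis by (simp only: Int_commute)
  qed
next
  case False
  then have "recolor u \<subseteq> base u" "recolor v \<subseteq> base v"
    by (blast intro!: recolor_subset_base)+
  moreover have "base u \<inter> base v = {}"
    unfolding base_def using c_disjoint[OF E] by blast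
  ultimately show ?thesis by blast
qed

lemma recolor_measure:
  assumes "v \<in> V"
  shows "recolor v \<in> lmeasurable \<and> recolor v \<subseteq> {0..<m} \<and> 1 \<le> measure lebesgue (recolor v)"
proof (cases "\<exists>n w. w \<in> W \<and> n \<le> 3 \<and> at_dist E n w v")
  case True
  then obtain n w where *: "w \<in> W" "n \<le> 3" "at_dist E n w v" by blast
  have "n = 1 \<Longrightarrow> E w v" using *(3) by (simp add: at_dist_def)
  then show ?thesis
    using near_measure[OF *(1) assms] near_subset[OF *(1)] by (simp add: recolor_near[OF *])
next
  case False
  then show ?thesis
    using base_measure[OF assms] unfolding recolor_base[OF False] by (auto simp: base_def)
qed

lemma recolor_W: "w \<in> W \<Longrightarrow> recolor w = p w"
  using recolor_near[of w 0 w] by (simp add: at_dist_def dist_ge_def)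

section \<open>Trimming to measure one and constructing the two maps\<close>

text \<open>The recolored sets may be too large. Shrinking them to measure one preserves
  disjointness.\<close>

lemma recolor_extends: "extends V E m W p"
proof -
  have "\<exists>A. A \<subseteq> recolor v \<and> unit_set m A" if "v \<in> V" for v
  proof -
    note v = recolor_measure[OF that]
    have "bounded (recolor v)"
      using v bounded_subset[OF bounded_Ico] by blast
    with v obtain A where A: "A \<subseteq> recolor v" "A \<in> lmeasurable" "measure lebesgue A = 1"
      using lmeasurable_subset_of_measure[of "recolor v" 1] by auto
    have "emeasure lebesgue A = 1"
      using emeasure_eq_measure2[OF A(2)] A(3) by simp
    with A v show ?thesis
      unfolding unit_set_def using fmeasurableD[OF A(2)] by blast
  qed
  then obtain d where d: "\<And>v. v \<in> V \<Longrightarrow> d v \<subseteq> recolor v" "\<And>v. v \<in> V \<Longrightarrow> unit_set m (d v)"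
    by metis
  \<comment> \<open>On \<open>W\<close> the trimmed set may miss a null set of \<open>p v\<close>,
    while an extension must agree with \<open>p\<close> exactly, so \<open>p v\<close> is
    restored.\<close>
  define d' where "d' v = (if v \<in> W then p v else d v)" for v
  have "d' v \<subseteq> recolor v" "unit_set m (d' v)" if "v \<in> V" for v
    using d[OF that] recolor_W p_unit by (auto simp: d'_def)
  then have "frac_coloring V E m d'"
    unfolding frac_coloring_def using recolor_disjoint edge_V by blast
  then show ?thesis
    unfolding extends_def by (intro exI[of _ d']) (auto simp: d'_def)
qed

end

theorem mainTheorem19:
  fixes V :: "'a set" and E :: "'a \<Rightarrow> 'a \<Rightarrow> bool" and W :: "'a set"
    and k \<epsilon> :: real and p :: "'a \<Rightarrow> real set"
  assumes "k \<in> \<rat>" and "0 < k" and "k < 3"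
    and "0 < \<epsilon>" and "\<epsilon> \<ge> 1 / (k + 1)"
    and "graph V E"
    and "frac_colorable V E k"
    and "W \<subseteq> V"
    and "\<forall>u\<in>W. \<forall>v\<in>W. u \<noteq> v \<longrightarrow> dist_ge E 7 u v"
    and "frac_precoloring W (k + \<epsilon>) p"
  shows "extends V E (k + \<epsilon>) W p"
proof (cases "V = {}")
  case True
  then show ?thesis
    using assms by (auto simp: extends_def frac_coloring_def graph_def)
next
  case False
  define m where "m = k + \<epsilon>"
  obtain c where c: "frac_coloring V E k c"
    using assms by (auto simp: frac_colorable_def)
  then have cu: "\<And>v. v \<in> V \<Longrightarrow> unit_set k (c v)" by (auto simp: frac_coloring_def)
  \<comment> \<open>A vertex exists, and its color set of measure one lies in
    \<open>[0,k)\<close>.\<close>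
  have k: "1 \<le> k" using False cu unit_set_ge_1 by blast
  have pu: "\<And>w. w \<in> W \<Longrightarrow> unit_set m (p w)"
    using assms by (auto simp: frac_precoloring_def m_def)
  have fin: "finite V" "finite W"
    using assms by (auto simp: graph_def intro: finite_subset)
  define F where "F = {{0..<m}} \<union> p ` W \<union> (\<lambda>w. {0..<m} - p w) ` W"
  define C where "C = (\<lambda>(u, v). c u \<inter> c v) ` (V \<times> V)"
  define D where "D = {{0..<(k + 1) / k}} \<union> C"
  have F: "finite F" "F \<subseteq> lmeasurable" "\<And>A. A \<in> F \<Longrightarrow> A \<subseteq> {0..<m}"
    using fin unit_setD(1,2)[OF pu]
    by (auto simp: F_def lmeasurable_ico intro!: fmeasurable.Diff)
  have C: "finite C" "C \<subseteq> lmeasurable" "\<And>B. B \<in> C \<Longrightarrow> B \<subseteq> {0..<k}"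
    using fin unit_setD(1,2)[OF cu] by (auto simp: C_def intro!: fmeasurable.Int)
  \<comment> \<open>The borrowing interval has to lie in the range \<open>[0,k+1)\<close> of
    \<open>h\<close>, which holds because \<open>1 \<le> k\<close>.\<close>
  have "(k + 1) / k \<le> k + 1"
    using mult_right_mono[of 1 k "k + 1"] k by (simp add: divide_le_eq mult.commute)
  moreover have "B \<subseteq> {0..<k + 1}" if "B \<in> C" for B
    using C(3)[OF that] by auto
  ultimately have D: "finite D" "D \<subseteq> lmeasurable" "\<And>B. B \<in> D \<Longrightarrow> B \<subseteq> {0..<k + 1}"
    using C(1,2) by (auto simp: D_def lmeasurable_ico)
  have bdd: "A \<subseteq> {0..<m} \<Longrightarrow> bounded A" for A
    by (auto intro: bounded_subset[OF bounded_Ico])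
  obtain g where g: "\<And>A B. A \<in> F \<Longrightarrow> B \<in> C \<Longrightarrow> A \<inter> g -` B \<in> lmeasurable"
    "\<And>A B. A \<in> F \<Longrightarrow> B \<in> C \<Longrightarrow>
      measure lebesgue (A \<inter> g -` B) = measure lebesgue A * measure lebesgue B / k"
    using independent_map[OF F(1,2) bdd[OF F(3)] C \<open>0 < k\<close>] by blast
  \<comment> \<open>Adding the sets already cut by \<open>g\<close> to the family makes
    \<open>h\<close> independent of \<open>g\<close> and the precolors jointly, which yields
    \<open>gh\<close>.\<close>
  define F' where "F' = F \<union> (\<lambda>(A, B). A \<inter> g -` B) ` (F \<times> C)"
  have F': "finite F'" "F' \<subseteq> lmeasurable" "\<And>A. A \<in> F' \<Longrightarrow> A \<subseteq> {0..<m}"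
    using F C g(1) by (auto simp: F'_def)
  have "0 < k + 1" using k by simp
  then obtain h where h: "\<And>A B. A \<in> F' \<Longrightarrow> B \<in> D \<Longrightarrow> A \<inter> h -` B \<in> lmeasurable"
    "\<And>A B. A \<in> F' \<Longrightarrow> B \<in> D \<Longrightarrow>
      measure lebesgue (A \<inter> h -` B) = measure lebesgue A * measure lebesgue B / (k + 1)"
    using independent_map[OF F'(1,2) bdd[OF F'(3)] D] by blast
  have FF': "A \<in> F \<Longrightarrow> A \<in> F'" "A \<in> F \<Longrightarrow> B \<in> C \<Longrightarrow> A \<inter> g -` B \<in> F'" for A B
    by (auto simp: F'_def)
  have CI: "u \<in> V \<Longrightarrow> v \<in> V \<Longrightarrow> c u \<inter> c v \<in> C" for u v
    by (auto simp: C_def)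
  interpret recoloring V E W k m c p g h
  proof (unfold_locales, fold C_def, fold F_def D_def)
    show "frac_precoloring W m p" "k + 1 / (k + 1) \<le> m"
      using assms by (auto simp: m_def)
    show "A \<inter> g -` (c u \<inter> c v) \<in> lmeasurable \<and> measure lebesgue (A \<inter> g -` (c u \<inter> c v))
        = measure lebesgue A * measure lebesgue (c u \<inter> c v) / k"
      if "A \<in> F" "u \<in> V" "v \<in> V" for A u v
      using g that CI by blast
    show "A \<inter> h -` B \<in> lmeasurable \<and>
      measure lebesgue (A \<inter> h -` B) = measure lebesgue A * measure lebesgue B / (k + 1)"
      if "A \<in> F" "B \<in> D" for A B
      using h FF'(1) that by blast
    show "A \<inter> g -` (c u \<inter> c v) \<inter> h -` B \<in> lmeasurable \<and>
      measure lebesgue (A \<inter> g -` (c u \<inter> c v) \<inter> h -` B)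
        = measure lebesgue A * measure lebesgue (c u \<inter> c v) / k * measure lebesgue B / (k + 1)"
      if "A \<in> F" "u \<in> V" "v \<in> V" "B \<in> D" for A u v B
      using h FF'(2) g(2) that CI by metis
  qed (use assms c k in auto)
  show ?thesis using recolor_extends by (simp add: m_def)
qed

end
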